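(* Let $f:\mathbb{C}^2\to\mathbb{C}$ be the mixed polynomial $$f(z_1,z_2)=z_2^2\bar z_2-6z_1^2z_2\bar z_2+11z_1^2\bar z_1^2z_2-6z_1^4\bar z_1^2 ,$$ let $V=f^{-1}(0)\subset\mathbb{C}^2$, and let $\hat\pi:X\to\mathbb{C}^2$ be the toric modification associated with the regular simplicial cone subdivision $\Sigma^*$ of $\mathbb{R}_{\ge0}^2$ whose vertices are $E_1={}^t(1,0)$, $S={}^t(1,1)$, $P={}^t(1,2)$, $E_2={}^t(0,1)$. Then the strict transform $\tilde V$ of $V$ via $\hat\pi$ is a real analytic manifold as a germ at $\tilde V\cap\hat\pi^{-1}(\mathbf 0)$; that is, there is an open neighbourhood $W$ of $\tilde V\cap\hat\pi^{-1}(\mathbf 0)$ in $X$ such that $\tilde V\cap W$ is a real analytic submanifold of $W$.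
   Context: $\bar z$ denotes complex conjugation. The subdivision $\Sigma^*$: its $2$-dimensional cones are $\sigma_1=\mathrm{Cone}(E_1,S)$, $\sigma_2=\mathrm{Cone}(S,P)$, $\sigma_3=\mathrm{Cone}(P,E_2)$, identified with the unimodular matrices (columns are the generating vectors) $$\sigma_1=\begin{pmatrix}1&1\\0&1\end{pmatrix},\quad \sigma_2=\begin{pmatrix}1&1\\1&2\end{pmatrix},\quad \sigma_3=\begin{pmatrix}1&0\\2&1\end{pmatrix}.$$ The toric modification: for an integer $2\times2$ matrix $\sigma=(a_{ij})$ write $\hat\pi_\sigma(u_1,u_2)=(u_1^{a_{11}}u_2^{a_{12}},\,u_1^{a_{21}}u_2^{a_{22}})$, defined wherever the monomials make sense. To each $\sigma_i$ is attached a toric chart $\mathbb{C}^2_{\sigma_i}\cong\mathbb{C}^2$. The smooth complex surface $X$ is obtained by gluing the three charts, identifying $\mathbf u\in\mathbb{C}^2_{\sigma_i}$ with $\mathbf u'\in\mathbb{C}^2_{\sigma_j}$ whenever the monomial map $\hat\pi_{\sigma_j^{-1}\sigma_i}$ is well defined at $\mathbf u$ and sends $\mathbf u$ to $\mathbf u'$. The maps $\hat\pi_{\sigma_i}:\mathbb{C}^2_{\sigma_i}\to\mathbb{C}^2$ glue to the proper map $\hat\pi:X\to\mathbb{C}^2$, i.e. $\hat\pi=\hat\pi_{\sigma_i}$ on $\mathbb{C}^2_{\sigma_i}$. It is biholomorphic over $\mathbb{C}^2\setminus\{\mathbf 0\}$, and $\hat\pi^{-1}(\mathbf 0)$ is the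 union of the two exceptional divisors $\hat E(S)$ and $\hat E(P)$ corresponding to $S$ and $P$. $X$ is regarded as a real analytic manifold of dimension $4$. The strict transform $\tilde V$ of $V$ is the closure in $X$ of $\hat\pi^{-1}(V\setminus\{\mathbf 0\})$. *)

theory Defs
  imports "HOL-Analysis.Analysis"
begin

section \<open>Real analytic maps between Euclidean spaces\<close>

text \<open>
  Around every point of the set, the map is the sum of a convergent power series in the real
  coordinates. The multi-indices are the functions from \<^term>\<open>Basis\<close> to the natural numbers
  (extensional, hence the \<^term>\<open>PiE\<close>), and \<^const>\<open>has_sum\<close> is unconditional convergence.
  The intended use is for open sets.
\<close>

definition real_analytic_on :: "('a::euclidean_space \<Rightarrow> 'b::real_normed_vector) \<Rightarrow> 'a set \<Rightarrow> bool"
    (infixl "(real'_analytic'_on)" 50) where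
  "f real_analytic_on U \<longleftrightarrow>
     (\<forall>p\<in>U. \<exists>r>0. \<exists>c. \<forall>x\<in>ball p r.
        ((\<lambda>\<alpha>. (\<Prod>b\<in>Basis. ((x - p) \<bullet> b) ^ \<alpha> b) *\<^sub>R c \<alpha>) has_sum f x)
          (Basis \<rightarrow>\<^sub>E (UNIV :: nat set)))"


section \<open>The fan\<close>

definition ray_E1 :: "int^2" where "ray_E1 = vector [1, 0]"
definition ray_S :: "int^2" where "ray_S = vector [1, 1]"
definition ray_P :: "int^2" where "ray_P = vector [1, 2]"
definition ray_E2 :: "int^2" where "ray_E2 = vector [0, 1]"

datatype cone = Cone_E1_S | Cone_S_P | Cone_P_E2

text \<open>The generating vectors of a cone are the \<^emph>\<open>columns\<close> of its matrix.\<close>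

fun cone_matrix :: "cone \<Rightarrow> int^2^2" where
  "cone_matrix Cone_E1_S = transpose (vector [ray_E1, ray_S])"
| "cone_matrix Cone_S_P = transpose (vector [ray_S, ray_P])"
| "cone_matrix Cone_P_E2 = transpose (vector [ray_P, ray_E2])"


section \<open>Monomial maps\<close>

definition monomial_map :: "int^2^2 \<Rightarrow> complex^2 \<Rightarrow> complex^2" where
  "monomial_map \<sigma> u = (\<chi> i. \<Prod>j\<in>UNIV. (u $ j) powi (\<sigma> $ i $ j))"

text \<open>The monomials make sense unless a negative power of \<open>0\<close> occurs.\<close>

definition monomial_map_defined :: "int^2^2 \<Rightarrow> complex^2 \<Rightarrow> bool" where
  "monomial_map_defined \<sigma> u \<longleftrightarrow> (\<forall>i j. \<sigma> $ i $ j < 0 \<longrightarrow> u $ j \<noteq> 0)"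

definition glue :: "cone \<times> (complex^2) \<Rightarrow> cone \<times> (complex^2) \<Rightarrow> bool" where
  "glue = (\<lambda>(i, u) (j, u').
     monomial_map_defined (matrix_inv (cone_matrix j) ** cone_matrix i) u \<and>
     monomial_map (matrix_inv (cone_matrix j) ** cone_matrix i) u = u')"

lemma matrix_inv_int_eqI:
  fixes A B :: "int^2^2"
  assumes "A ** B = mat 1" "B ** A = mat 1"
  shows "matrix_inv A = B"
proof -
  have "A ** matrix_inv A = mat 1 \<and> matrix_inv A ** A = mat 1"
    unfolding matrix_inv_def by (rule someI[of _ B]) (use assms in simp)
  then show ?thesis
    by (metis assms(2) matrix_mul_assoc matrix_mul_lid matrix_mul_rid)
qed

lemmas mat2_simps = vec_eq_iff forall_2 matrix_matrix_mult_def sum_2 mat_def transpose_def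

lemma cone_matrix_explicit:
  "cone_matrix Cone_E1_S = vector [vector [1, 1], vector [0, 1]]"
  "cone_matrix Cone_S_P = vector [vector [1, 1], vector [1, 2]]"
  "cone_matrix Cone_P_E2 = vector [vector [1, 0], vector [2, 1]]"
  by (simp_all add: mat2_simps ray_E1_def ray_S_def ray_P_def ray_E2_def)

declare cone_matrix.simps [simp del]

lemma matrix_inv_cone_matrix:
  "matrix_inv (cone_matrix Cone_E1_S) = vector [vector [1, -1], vector [0, 1]]"
  "matrix_inv (cone_matrix Cone_S_P) = vector [vector [2, -1], vector [-1, 1]]"
  "matrix_inv (cone_matrix Cone_P_E2) = vector [vector [1, 0], vector [-2, 1]]"
  by (rule matrix_inv_int_eqI; simp add: cone_matrix_explicit mat2_simps)+

lemma monomial_map_nth: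
  "monomial_map \<sigma> u $ i = (u $ 1) powi (\<sigma> $ i $ 1) * (u $ 2) powi (\<sigma> $ i $ 2)"
  by (simp add: monomial_map_def UNIV_2)

lemma monomial_map_eq_iff:
  "monomial_map \<sigma> u = v \<longleftrightarrow>
     v $ 1 = (u $ 1) powi (\<sigma> $ 1 $ 1) * (u $ 2) powi (\<sigma> $ 1 $ 2) \<and>
     v $ 2 = (u $ 1) powi (\<sigma> $ 2 $ 1) * (u $ 2) powi (\<sigma> $ 2 $ 2)"
  by (auto simp: vec_eq_iff forall_2 monomial_map_nth)

lemma glue_iff:
  "glue (Cone_E1_S, u) (Cone_E1_S, v) \<longleftrightarrow> v $ 1 = u $ 1 \<and> v $ 2 = u $ 2"
  "glue (Cone_S_P, u) (Cone_S_P, v) \<longleftrightarrow> v $ 1 = u $ 1 \<and> v $ 2 = u $ 2"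
  "glue (Cone_P_E2, u) (Cone_P_E2, v) \<longleftrightarrow> v $ 1 = u $ 1 \<and> v $ 2 = u $ 2"
  "glue (Cone_E1_S, u) (Cone_S_P, v) \<longleftrightarrow>
     u $ 1 \<noteq> 0 \<and> v $ 1 = (u $ 1)\<^sup>2 * u $ 2 \<and> v $ 2 = inverse (u $ 1)"
  "glue (Cone_S_P, u) (Cone_E1_S, v) \<longleftrightarrow>
     u $ 2 \<noteq> 0 \<and> v $ 1 = inverse (u $ 2) \<and> v $ 2 = u $ 1 * (u $ 2)\<^sup>2"
  "glue (Cone_S_P, u) (Cone_P_E2, v) \<longleftrightarrow>
     u $ 1 \<noteq> 0 \<and> v $ 1 = u $ 1 * u $ 2 \<and> v $ 2 = inverse (u $ 1)"
  "glue (Cone_P_E2, u) (Cone_S_P, v) \<longleftrightarrow>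
     u $ 2 \<noteq> 0 \<and> v $ 1 = inverse (u $ 2) \<and> v $ 2 = u $ 1 * u $ 2"
  "glue (Cone_E1_S, u) (Cone_P_E2, v) \<longleftrightarrow>
     u $ 1 \<noteq> 0 \<and> u $ 2 \<noteq> 0 \<and> v $ 1 = u $ 1 * u $ 2 \<and> v $ 2 = inverse ((u $ 1)\<^sup>2 * u $ 2)"
  "glue (Cone_P_E2, u) (Cone_E1_S, v) \<longleftrightarrow>
     u $ 1 \<noteq> 0 \<and> u $ 2 \<noteq> 0 \<and> v $ 1 = inverse (u $ 1 * u $ 2) \<and> v $ 2 = (u $ 1)\<^sup>2 * u $ 2"
  by (auto simp: glue_def cone_matrix_explicit matrix_inv_cone_matrix[unfolded cone_matrix_explicit]
      matrix_matrix_mult_def sum_2 monomial_map_eq_iff monomial_map_defined_def forall_2 power_int_minus)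

lemma glue_refl: "glue (i, u) (i, u)"
  by (cases i) (simp_all add: glue_iff)

lemma glue_sym: "glue (i, u) (j, v) \<Longrightarrow> glue (j, v) (i, u)"
  apply (cases i; cases j)
          apply (simp_all add: glue_iff vec_eq_iff forall_2 power2_eq_square)
     apply (simp_all (no_asm_simp) add: field_simps)?
  done

lemma glue_trans: "glue (i, u) (j, v) \<Longrightarrow> glue (j, v) (k, w) \<Longrightarrow> glue (i, u) (k, w)"
  apply (cases i; cases j; cases k)
                      apply (simp_all add: glue_iff vec_eq_iff forall_2 power2_eq_square)
       apply (simp_all (no_asm_simp) add: field_simps)?
  done

lemma equivp_glue: "equivp glue"
proof (intro equivpI reflpI sympI transpI)
  show "glue x x" for x
    using glue_refl by (cases x) simp
  show "glue y x" if "glue x y" for x y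
    using that glue_sym by (cases x; cases y) simp
  show "glue x z" if "glue x y" "glue y z" for x y z
    using that glue_trans by (cases x; cases y; cases z) metis
qed

lemma glue_imp_monomial_map_eq:
  "glue (i, u) (j, v) \<Longrightarrow> monomial_map (cone_matrix i) u = monomial_map (cone_matrix j) v"
  apply (cases i; cases j)
          apply (simp_all add: glue_iff cone_matrix_explicit monomial_map_eq_iff monomial_map_nth
            power2_eq_square)
     apply (simp_all (no_asm_simp) add: field_simps)?
  done


section \<open>The toric surface and the toric modification\<close>

quotient_type toric_surface = "cone \<times> (complex^2)" / glue
  by (rule equivp_glue)

definition toric_chart :: "cone \<Rightarrow> complex^2 \<Rightarrow> toric_surface" where
  "toric_chart i u = abs_toric_surface (i, u)"

instantiation toric_surface :: topological_space
begin

text \<open>The quotient topology.\<close>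

definition open_toric_surface :: "toric_surface set \<Rightarrow> bool" where
  "open_toric_surface U \<longleftrightarrow> (\<forall>i. open (toric_chart i -` U))"

instance
proof
  show "open (UNIV :: toric_surface set)"
    by (simp add: open_toric_surface_def)
  show "open (U \<inter> U')" if "open U" "open U'" for U U' :: "toric_surface set"
    using that by (simp add: open_toric_surface_def vimage_Int open_Int)
  show "open (\<Union>K)" if "\<forall>U\<in>K. open U" for K :: "toric_surface set set"
    using that by (auto simp: open_toric_surface_def vimage_Union)
qed

end

lift_definition toric_modification :: "toric_surface \<Rightarrow> complex^2"
  is "\<lambda>(i, u). monomial_map (cone_matrix i) u"
  by (simp add: case_prod_beta glue_imp_monomial_map_eq split: prod.splits)

lemma toric_modification_chart:
  "toric_modification (toric_chart i u) = monomial_map (cone_matrix i) u"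
  by (simp add: toric_chart_def toric_modification.abs_eq)

definition strict_transform :: "(complex^2) set \<Rightarrow> toric_surface set" where
  "strict_transform V = closure (toric_modification -` (V - {0}))"


section \<open>Real analytic submanifolds of the toric surface\<close>

text \<open>
  The members of the maximal real analytic atlas that contains the toric charts;
  \<^typ>\<open>complex^2\<close> serves as the real Euclidean space of dimension 4.
\<close>

definition real_analytic_chart :: "toric_surface set \<Rightarrow> (toric_surface \<Rightarrow> complex^2) \<Rightarrow> bool" where
  "real_analytic_chart U \<phi> \<longleftrightarrow>
     open U \<and> open (\<phi> ` U) \<and> homeomorphism U (\<phi> ` U) \<phi> (inv_into U \<phi>) \<and>
     (\<forall>i. (\<phi> \<circ> toric_chart i) real_analytic_on (toric_chart i -` U) \<and>
          (inv (toric_chart i) \<circ> inv_into U \<phi>) real_analytic_on (\<phi> ` (U \<inter> range (toric_chart i))))"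

text \<open>
  Embedded submanifolds of an open set \<open>W\<close>, of some dimension \<open>k\<close>: near each point there is a
  chart that flattens \<open>M\<close>. Here \<^const>\<open>subspace\<close> and \<^const>\<open>dim\<close> refer to the \<^emph>\<open>real\<close> vector
  space structure.
\<close>

definition real_analytic_submanifold :: "toric_surface set \<Rightarrow> toric_surface set \<Rightarrow> bool" where
  "real_analytic_submanifold W M \<longleftrightarrow>
     M \<subseteq> W \<and>
     (\<exists>k. \<forall>p\<in>M. \<exists>U \<phi> L. real_analytic_chart U \<phi> \<and> p \<in> U \<and> U \<subseteq> W \<and>
        subspace L \<and> dim L = k \<and> \<phi> ` (M \<inter> U) = \<phi> ` U \<inter> L)"

end

theory Submission
  imports Defs "HOL-Complex_Analysis.Cauchy_Integral_Formula"
begin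

text \<open>
  Both the radial and the polar weights of the four monomials of \<open>f\<close> agree for the weight vector
  \<open>P = (1, 2)\<close>. Hence, for \<open>z1 \<noteq> 0\<close> and \<open>w = z2 / z1\<^sup>2\<close>, the value of \<open>f\<close> is a nonzero multiple of
  \<open>w\<^sup>2 w' - 6 w w' + 11 w - 6\<close>, where \<open>w'\<close> is the conjugate of \<open>w\<close>. At a zero,
  \<open>w (\<bar>w\<bar>\<^sup>2 + 11) = 6 (\<bar>w\<bar>\<^sup>2 + 1)\<close>, so \<open>w\<close> is real and is a root of \<open>(w - 1) (w - 2) (w - 3)\<close>
  (\<open>mixed_cubic_eq_0_iff\<close>). Thus \<open>V\<close> is the union of the three parabolas \<open>z2 = c z1\<^sup>2\<close> with
  \<open>c \<in> {1, 2, 3}\<close> (\<open>zero_set_parabolas\<close>).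

  In the toric chart of the cone spanned by \<open>P\<close> and \<open>E2\<close>, where \<open>z = (u1, u1\<^sup>2 u2)\<close>, the parabolas lift
  to the disjoint complex lines \<open>u2 = c\<close>. Their union is already closed in the whole surface, because
  in the other two charts it is the preimage of a finite set under a monomial; therefore it is the
  strict transform (\<open>strict_transform_eq\<close>). Near each point only one line is present, and the toric
  chart, translated so that this line becomes \<open>u2 = 0\<close>, flattens it; so the strict transform is a
  submanifold of the entire surface.

  The remaining point is that a translated toric chart belongs to the real analytic atlas
  (\<open>real_analytic_chart_toric\<close>): the changes of charts are monomial maps, possibly with negative
  exponents. Each factor of such a map is a holomorphic function of one coordinate, whose power series
  becomes a real power series by the binomial theorem (\<open>real_analytic_on_holomorphic_nth\<close>), and real
  analytic functions are closed under products (\<open>real_analytic_on_mult\<close>). The series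
  obtained in this way are indexed by pairs instead of multi-indices, and for products a monomial
  occurs several times; \<open>real_analytic_onI_family\<close> collects the terms.
\<close>

section \<open>Operations on real analytic maps\<close>

definition monomial_at :: "'a::euclidean_space \<Rightarrow> 'a \<Rightarrow> ('a \<Rightarrow> nat) \<Rightarrow> real" where
  "monomial_at p x \<alpha> = (\<Prod>b\<in>Basis. ((x - p) \<bullet> b) ^ \<alpha> b)"

definition power_series_on ::
    "('a::euclidean_space \<Rightarrow> 'b::real_normed_vector) \<Rightarrow> 'a \<Rightarrow> real \<Rightarrow> (('a \<Rightarrow> nat) \<Rightarrow> 'b) \<Rightarrow> bool" where
  "power_series_on f p r c \<longleftrightarrow> r > 0 \<and>
     (\<forall>x\<in>ball p r. ((\<lambda>\<alpha>. monomial_at p x \<alpha> *\<^sub>R c \<alpha>) has_sum f x) (Basis \<rightarrow>\<^sub>E UNIV))"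

lemma real_analytic_on_iff:
  "f real_analytic_on U \<longleftrightarrow> (\<forall>p\<in>U. \<exists>r c. power_series_on f p r c)"
  by (simp add: real_analytic_on_def power_series_on_def monomial_at_def)

lemma real_analytic_on_subset:
  "f real_analytic_on U \<Longrightarrow> V \<subseteq> U \<Longrightarrow> f real_analytic_on V"
  by (auto simp: real_analytic_on_iff)

lemma real_analytic_on_cong:
  assumes "open U" and "f real_analytic_on U" and eq: "\<And>x. x \<in> U \<Longrightarrow> f x = g x"
  shows "g real_analytic_on U"
  unfolding real_analytic_on_iff
proof
  fix p assume "p \<in> U"
  then obtain r c where c: "power_series_on f p r c"
    using assms(2) unfolding real_analytic_on_iff by blast
  obtain s where "s > 0" and s: "ball p s \<subseteq> U"
    using \<open>open U\<close> \<open>p \<in> U\<close> by (auto simp: open_contains_ball)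
  have "power_series_on g p (min r s) c"
    unfolding power_series_on_def
  proof safe
    fix x assume "x \<in> ball p (min r s)"
    then have "x \<in> ball p r" "f x = g x" using s eq by auto
    with c have "((\<lambda>\<alpha>. monomial_at p x \<alpha> *\<^sub>R c \<alpha>) has_sum f x) (Basis \<rightarrow>\<^sub>E UNIV)"
      unfolding power_series_on_def by blast
    then show "((\<lambda>\<alpha>. monomial_at p x \<alpha> *\<^sub>R c \<alpha>) has_sum g x) (Basis \<rightarrow>\<^sub>E UNIV)"
      by (simp only: \<open>f x = g x\<close>)
  qed (use c \<open>s > 0\<close> in \<open>auto simp: power_series_on_def\<close>)
  then show "\<exists>r c. power_series_on g p r c" by blast
qed

lemma real_analytic_on_translation:
  assumes "f real_analytic_on (\<lambda>x. x + a) ` U"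
  shows "(\<lambda>x. f (x + a)) real_analytic_on U"
  unfolding real_analytic_on_iff
proof
  fix p assume "p \<in> U"
  then obtain r c where c: "power_series_on f (p + a) r c"
    using assms unfolding real_analytic_on_iff by blast
  have "power_series_on (\<lambda>x. f (x + a)) p r c"
    unfolding power_series_on_def
  proof safe
    fix x assume "x \<in> ball p r"
    then have "x + a \<in> ball (p + a) r" by (simp add: dist_norm)
    with c have "((\<lambda>\<alpha>. monomial_at (p + a) (x + a) \<alpha> *\<^sub>R c \<alpha>) has_sum f (x + a)) (Basis \<rightarrow>\<^sub>E UNIV)"
      unfolding power_series_on_def by blast
    then show "((\<lambda>\<alpha>. monomial_at p x \<alpha> *\<^sub>R c \<alpha>) has_sum f (x + a)) (Basis \<rightarrow>\<^sub>E UNIV)"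
      by (simp add: monomial_at_def)
  qed (use c in \<open>auto simp: power_series_on_def\<close>)
  then show "\<exists>r c. power_series_on (\<lambda>x. f (x + a)) p r c" by blast
qed

lemma real_analytic_on_vec:
  fixes f :: "'a::euclidean_space \<Rightarrow> 'b::real_normed_vector^'n"
  assumes "\<And>i. (\<lambda>x. f x $ i) real_analytic_on U"
  shows "f real_analytic_on U"
  unfolding real_analytic_on_iff
proof
  fix p assume "p \<in> U"
  then have "\<exists>r c. power_series_on (\<lambda>x. f x $ i) p r c" for i
    using assms[of i] unfolding real_analytic_on_iff by blast
  then obtain r c where rc: "\<And>i. power_series_on (\<lambda>x. f x $ i) p (r i) (c i)"
    by metis
  have "power_series_on f p (Min (range r)) (\<lambda>\<alpha>. \<chi> i. c i \<alpha>)"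
    unfolding power_series_on_def
  proof safe
    show "Min (range r) > 0"
      using rc by (simp add: power_series_on_def)
    fix x assume x: "x \<in> ball p (Min (range r))"
    have "((\<lambda>\<alpha>. monomial_at p x \<alpha> *\<^sub>R c i \<alpha>) has_sum f x $ i) (Basis \<rightarrow>\<^sub>E UNIV)" for i
    proof -
      have "x \<in> ball p (r i)"
        using x by simp
      then show ?thesis
        using rc[of i] unfolding power_series_on_def by blast
    qed
    then show "((\<lambda>\<alpha>. monomial_at p x \<alpha> *\<^sub>R (\<chi> i. c i \<alpha>)) has_sum f x) (Basis \<rightarrow>\<^sub>E UNIV)"
      unfolding has_sum_def by (intro vec_tendstoI) simp
  qed
  then show "\<exists>r c. power_series_on f p r c" by blast
qed

lemma real_analytic_on_add:
  assumes "f real_analytic_on U" and "g real_analytic_on U"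
  shows "(\<lambda>x. f x + g x) real_analytic_on U"
  unfolding real_analytic_on_iff
proof
  fix p assume "p \<in> U"
  then obtain r c s d where f: "power_series_on f p r c" and g: "power_series_on g p s d"
    using assms unfolding real_analytic_on_iff by blast
  have "power_series_on (\<lambda>x. f x + g x) p (min r s) (\<lambda>\<alpha>. c \<alpha> + d \<alpha>)"
    using f g by (auto simp: power_series_on_def scaleR_add_right intro: has_sum_add)
  then show "\<exists>r c. power_series_on (\<lambda>x. f x + g x) p r c" by blast
qed

text \<open>
  A sum over any index set \<open>J\<close>, in which the exponents \<open>\<alpha> j\<close> may repeat, is as good as a power series:
  unconditional convergence permits summing over the fibres of \<open>\<alpha>\<close> first, which collects the
  coefficients of each monomial.
\<close>

lemma real_analytic_onI_family:
  fixes f :: "'a::euclidean_space \<Rightarrow> 'b::banach"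
  assumes "\<And>p. p \<in> U \<Longrightarrow> \<exists>r>0. \<exists>(J :: 'j set) \<alpha> c. \<forall>x\<in>ball p r.
    ((\<lambda>j. monomial_at p x (\<alpha> j) *\<^sub>R c j) has_sum f x) J"
  shows "f real_analytic_on U"
  unfolding real_analytic_on_iff
proof
  fix p assume "p \<in> U"
  then obtain r c and J :: "'j set" and \<alpha> :: "'j \<Rightarrow> 'a \<Rightarrow> nat" where "r > 0" and
    sum: "\<And>x. x \<in> ball p r \<Longrightarrow> ((\<lambda>j. monomial_at p x (\<alpha> j) *\<^sub>R c j) has_sum f x) J"
    using assms by metis
  define \<beta> where "\<beta> j = restrict (\<alpha> j) Basis" for j
  define Fib where "Fib \<gamma> = {j\<in>J. \<beta> j = \<gamma>}" for \<gamma>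
  have sum': "((\<lambda>j. monomial_at p x (\<beta> j) *\<^sub>R c j) has_sum f x) J" if "x \<in> ball p r" for x
    using sum[OF that] by (simp add: monomial_at_def \<beta>_def)
  \<comment> \<open>No monomial vanishes at \<open>x0\<close>, so the coefficients in a fibre are summable themselves.\<close>
  have c_sum: "(c has_sum infsum c (Fib \<gamma>)) (Fib \<gamma>)" for \<gamma>
  proof -
    define one :: 'a where "one = (\<Sum>b\<in>Basis. b)"
    define s where "s = r / 2 / (norm one + 1)"
    define x0 where "x0 = p + s *\<^sub>R one"
    have "s > 0"
      using \<open>r > 0\<close> by (auto simp: s_def intro!: divide_pos_pos add_nonneg_pos)
    have "s * norm one < r"
    proof -
      have "s * norm one \<le> s * (norm one + 1)"
        using \<open>s > 0\<close> by (intro mult_left_mono) auto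
      also have "s * (norm one + 1) = r / 2"
        using add_nonneg_pos[OF norm_ge_zero zero_less_one, of one] unfolding s_def
        by (intro nonzero_eq_divide_eq[THEN iffD1, OF _ refl]) simp
      finally show ?thesis using \<open>r > 0\<close> by simp
    qed
    then have "x0 \<in> ball p r"
      using \<open>s > 0\<close> by (simp add: x0_def dist_norm)
    have "monomial_at p x0 \<gamma> \<noteq> 0"
      using \<open>s > 0\<close> by (simp add: monomial_at_def x0_def one_def inner_sum_left_Basis)
    have "(\<lambda>j. monomial_at p x0 (\<beta> j) *\<^sub>R c j) summable_on Fib \<gamma>"
      using sum'[OF \<open>x0 \<in> ball p r\<close>] summable_on_subset_banach
      by (fastforce simp: Fib_def dest: has_sum_imp_summable)
    then have "(\<lambda>j. monomial_at p x0 \<gamma> *\<^sub>R c j) summable_on Fib \<gamma>"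
      by (rule summable_on_cong[THEN iffD1, rotated]) (simp add: Fib_def)
    then have "(\<lambda>j. inverse (monomial_at p x0 \<gamma>) *\<^sub>R monomial_at p x0 \<gamma> *\<^sub>R c j) summable_on Fib \<gamma>"
      by (rule summable_on_scaleR_right)
    with \<open>monomial_at p x0 \<gamma> \<noteq> 0\<close> show ?thesis by simp
  qed
  have "((\<lambda>\<gamma>. monomial_at p x \<gamma> *\<^sub>R infsum c (Fib \<gamma>)) has_sum f x) (Basis \<rightarrow>\<^sub>E UNIV)" if "x \<in> ball p r" for x
  proof (rule has_sum_SigmaD)
    have "((\<lambda>j. monomial_at p x (\<beta> j) *\<^sub>R c j) has_sum f x) J \<longleftrightarrow>
      ((\<lambda>(\<gamma>, j). monomial_at p x \<gamma> *\<^sub>R c j) has_sum f x) (Sigma (Basis \<rightarrow>\<^sub>E UNIV) Fib)"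
      by (rule has_sum_reindex_bij_witness[where i = snd and j = "\<lambda>j. (\<beta> j, j)"])
        (auto simp: Fib_def \<beta>_def)
    then show "((\<lambda>(\<gamma>, j). monomial_at p x \<gamma> *\<^sub>R c j) has_sum f x) (Sigma (Basis \<rightarrow>\<^sub>E UNIV) Fib)"
      using sum'[OF that] by simp
    show "((\<lambda>j. case (\<gamma>, j) of (\<gamma>, j) \<Rightarrow> monomial_at p x \<gamma> *\<^sub>R c j) has_sum monomial_at p x \<gamma> *\<^sub>R infsum c (Fib \<gamma>)) (Fib \<gamma>)"
      for \<gamma>
      using has_sum_scaleR[OF c_sum] by simp
  qed
  with \<open>r > 0\<close> have "power_series_on f p r (\<lambda>\<gamma>. infsum c (Fib \<gamma>))"
    by (simp add: power_series_on_def)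
  then show "\<exists>r c. power_series_on f p r c" by blast
qed

text \<open>
  Unconditional convergence of complex families is absolute convergence, so the double family
  converges and may be summed iteratively.
\<close>

lemma has_sum_mult_Times_complex:
  fixes f :: "'i \<Rightarrow> complex" and g :: "'j \<Rightarrow> complex"
  assumes f: "(f has_sum F) A" and g: "(g has_sum G) B"
  shows "((\<lambda>(i, j). f i * g j) has_sum (F * G)) (A \<times> B)"
proof (rule has_sum_SigmaI)
  have "(\<lambda>i. norm (f i)) summable_on A" "(\<lambda>j. norm (g j)) summable_on B"
    using f g by (auto simp flip: summable_on_iff_abs_summable_on_complex dest: has_sum_imp_summable)
  then obtain F' G' where F': "((\<lambda>i. norm (f i)) has_sum F') A"
    and G': "((\<lambda>j. norm (g j)) has_sum G') B"
    unfolding summable_on_def by blast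
  have "(\<lambda>(i, j). norm (f i) * norm (g j)) summable_on A \<times> B"
    by (rule summable_on_SigmaI[where g = "\<lambda>i. norm (f i) * G'"])
      (auto intro: has_sum_cmult_right[OF G'] has_sum_imp_summable[OF has_sum_cmult_left[OF F']])
  then show "(\<lambda>(i, j). f i * g j) summable_on A \<times> B"
    unfolding summable_on_iff_abs_summable_on_complex
    by (simp add: case_prod_unfold norm_mult)
qed (auto intro: has_sum_cmult_right[OF g] has_sum_cmult_left[OF f])

text \<open>
  The product of the two series is indexed by pairs of multi-indices, and the exponents add up.
\<close>

lemma real_analytic_on_mult:
  fixes f g :: "'a::euclidean_space \<Rightarrow> complex"
  assumes "f real_analytic_on U" and "g real_analytic_on U"
  shows "(\<lambda>x. f x * g x) real_analytic_on U"
proof (rule real_analytic_onI_family)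
  fix p assume "p \<in> U"
  then obtain r c s d where f: "power_series_on f p r c" and g: "power_series_on g p s d"
    using assms unfolding real_analytic_on_iff by blast
  define J where "J = ((Basis :: 'a set) \<rightarrow>\<^sub>E (UNIV :: nat set)) \<times> ((Basis :: 'a set) \<rightarrow>\<^sub>E (UNIV :: nat set))"
  define \<gamma> where "\<gamma> j b = fst j b + snd j b" for j :: "('a \<Rightarrow> nat) \<times> ('a \<Rightarrow> nat)" and b
  have "((\<lambda>j. monomial_at p x (\<gamma> j) *\<^sub>R (c (fst j) * d (snd j))) has_sum f x * g x) J"
    if "x \<in> ball p (min r s)" for x
  proof -
    have "((\<lambda>(\<alpha>, \<beta>). (monomial_at p x \<alpha> *\<^sub>R c \<alpha>) * (monomial_at p x \<beta> *\<^sub>R d \<beta>)) has_sum f x * g x) J"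
      unfolding J_def using f g that
      by (intro has_sum_mult_Times_complex) (auto simp: power_series_on_def)
    then show ?thesis
      by (simp add: case_prod_unfold \<gamma>_def monomial_at_def power_add prod.distrib mult.commute)
  qed
  moreover have "min r s > 0"
    using f g by (simp add: power_series_on_def)
  ultimately show "\<exists>r>0. \<exists>J (\<alpha> :: ('a \<Rightarrow> nat) \<times> ('a \<Rightarrow> nat) \<Rightarrow> 'a \<Rightarrow> nat) c. \<forall>x\<in>ball p r.
      ((\<lambda>j. monomial_at p x (\<alpha> j) *\<^sub>R c j) has_sum f x * g x) J"
    by (intro exI[of _ "min r s"] conjI exI[of _ J] exI[of _ \<gamma>]
        exI[of _ "\<lambda>j. c (fst j) * d (snd j)"] ballI)
qed

text \<open>
  Around \<open>q = p $ i\<close> the expansion is \<open>F (q + x + \<i> y) = (\<Sum>n. a n * (x + \<i> y) ^ n)\<close>, and the coordinates \<open>x\<close> and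
  \<open>y\<close> of the displacement belong to the basis vectors \<open>axis i 1\<close> and \<open>axis i \<i>\<close>. Expanding the powers by
  the binomial theorem gives the real power series. The absolute values in degree \<open>n\<close>
  sum to \<open>\<bar>a n\<bar> (\<bar>x\<bar> + \<bar>y\<bar>) ^ n\<close>, so the series converges absolutely where
  \<open>\<bar>x\<bar> + \<bar>y\<bar>\<close>, and not merely \<open>\<bar>x + \<i> y\<bar>\<close>, is less than the radius \<open>R\<close> for \<open>F\<close>; this holds on the
  ball of radius \<open>R / 3\<close>.
\<close>

lemma real_analytic_on_holomorphic_nth:
  fixes F :: "complex \<Rightarrow> complex" and i :: "'n::finite"
  assumes hol: "F holomorphic_on S" and "open S" and US: "\<And>u. u \<in> U \<Longrightarrow> u $ i \<in> S"
  shows "(\<lambda>u :: complex^'n. F (u $ i)) real_analytic_on U"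
proof (rule real_analytic_onI_family)
  fix p :: "complex^'n" assume "p \<in> U"
  define q where "q = p $ i"
  obtain R where "R > 0" and "ball q R \<subseteq> S"
    using US[OF \<open>p \<in> U\<close>] \<open>open S\<close> by (auto simp: q_def open_contains_ball)
  define a where "a n = (deriv ^^ n) F q / fact n" for n
  have F: "(\<lambda>n. a n * w ^ n) sums F (q + w)" if "norm w < R" for w
    using holomorphic_power_series[of F q R "q + w"] that hol \<open>ball q R \<subseteq> S\<close>
    by (auto simp: a_def dist_norm intro: holomorphic_on_subset)
  define J where "J = (SIGMA n:UNIV. {..n::nat})"
  define c where "c = (\<lambda>(n, k). a n * of_nat (n choose k) * \<i> ^ (n - k))"
  define \<alpha> :: "nat \<times> nat \<Rightarrow> complex^'n \<Rightarrow> nat"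
    where "\<alpha> = (\<lambda>(n, k) b. if b = axis i 1 then k else if b = axis i \<i> then n - k else 0)"
  have "((\<lambda>j. monomial_at p u (\<alpha> j) *\<^sub>R c j) has_sum F (u $ i)) J"
    if u: "u \<in> ball p (R / 3)" for u
  proof -
    define w where "w = u $ i - q"
    define x y where "x = Re w" and "y = Im w"
    have "norm w < R / 3"
      using u Finite_Cartesian_Product.norm_nth_le[of "u - p" i]
      by (auto simp: w_def q_def dist_norm norm_minus_commute)
    define t where "t = \<bar>x\<bar> + \<bar>y\<bar>"
    have "0 \<le> t" "t < 2 * R / 3"
      using \<open>norm w < R / 3\<close> abs_Re_le_cmod[of w] abs_Im_le_cmod[of w]
      by (auto simp: t_def x_def y_def)
    have mon: "monomial_at p u (\<alpha> (n, k)) = x ^ k * y ^ (n - k)" for n k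
    proof -
      have ne: "axis i 1 \<noteq> (axis i \<i> :: complex^'n)"
        by (simp add: axis_eq_axis complex_eq_iff)
      have "monomial_at p u (\<alpha> (n, k)) =
          (\<Prod>b\<in>{axis i 1, axis i \<i>}. ((u - p) \<bullet> b) ^ \<alpha> (n, k) b)"
        unfolding monomial_at_def by (rule prod.mono_neutral_right) (auto simp: \<alpha>_def Basis_complex_def)
      also have "\<dots> = x ^ k * y ^ (n - k)"
        using ne by (simp add: \<alpha>_def inner_axis x_def y_def w_def q_def)
      finally show ?thesis .
    qed
    have summand: "(x ^ k * y ^ (n - k)) *\<^sub>R c (n, k) =
        a n * (of_nat (n choose k) * of_real x ^ k * (\<i> * of_real y) ^ (n - k))" for n k
      by (simp add: c_def scaleR_conv_of_real power_mult_distrib)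
    have summ: "summable (\<lambda>n. norm (a n * of_real s ^ n))" if "0 \<le> s" "s < 2 * R / 3" for s :: real
      by (rule powser_insidea[where x = "of_real (2 * R / 3)"])
        (use F[of "of_real (2 * R / 3)"] that \<open>R > 0\<close> in \<open>auto simp: sums_iff norm_mult\<close>)
    have "((\<lambda>(n, k). (x ^ k * y ^ (n - k)) *\<^sub>R c (n, k)) has_sum F (u $ i)) J"
      unfolding J_def
    proof (rule has_sum_SigmaI)
      fix n :: nat
      have "w = of_real x + \<i> * of_real y"
        by (simp add: x_def y_def complex_eq_iff)
      then have "a n * w ^ n = (\<Sum>k\<le>n. (x ^ k * y ^ (n - k)) *\<^sub>R c (n, k))"
        unfolding summand by (simp only: binomial_ring sum_distrib_left)
      then show "((\<lambda>k. case (n, k) of (n, k) \<Rightarrow> (x ^ k * y ^ (n - k)) *\<^sub>R c (n, k)) has_sum a n * w ^ n) {..n}"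
        by (simp add: has_sum_finiteI)
    next
      have "norm w < 2 * R / 3"
        using \<open>norm w < R / 3\<close> \<open>R > 0\<close> by simp
      then have "summable (\<lambda>n. norm (a n * w ^ n))"
        using summ[of "norm w"] by (simp add: norm_mult norm_power)
      moreover have "(\<lambda>n. a n * w ^ n) sums F (u $ i)"
        using F[of w] \<open>norm w < 2 * R / 3\<close> \<open>R > 0\<close> by (simp add: w_def)
      ultimately show "((\<lambda>n. a n * w ^ n) has_sum F (u $ i)) UNIV"
        by (rule norm_summable_imp_has_sum)
    next
      have "(\<lambda>(n, k). norm ((x ^ k * y ^ (n - k)) *\<^sub>R c (n, k))) summable_on (SIGMA n:UNIV. {..n})"
      proof (rule summable_on_SigmaI)
        fix n :: nat
        have "norm (a n) * t ^ n = (\<Sum>k\<le>n. norm ((x ^ k * y ^ (n - k)) *\<^sub>R c (n, k)))"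
          unfolding summand t_def
          by (simp add: binomial_ring sum_distrib_left norm_mult norm_power power_abs)
        then show "((\<lambda>k. case (n, k) of (n, k) \<Rightarrow> norm ((x ^ k * y ^ (n - k)) *\<^sub>R c (n, k)))
            has_sum norm (a n) * t ^ n) {..n}"
          by (simp add: has_sum_finiteI)
      next
        show "(\<lambda>n. norm (a n) * t ^ n) summable_on UNIV"
          using summ[OF \<open>0 \<le> t\<close> \<open>t < 2 * R / 3\<close>] \<open>0 \<le> t\<close>
          by (intro norm_summable_imp_summable_on) (simp add: norm_mult norm_power)
      qed simp
      then show "(\<lambda>(n, k). (x ^ k * y ^ (n - k)) *\<^sub>R c (n, k)) summable_on (SIGMA n:UNIV. {..n})"
        unfolding summable_on_iff_abs_summable_on_complex by (simp add: case_prod_unfold)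
    qed
    also have "(\<lambda>(n, k). (x ^ k * y ^ (n - k)) *\<^sub>R c (n, k)) =
        (\<lambda>j. monomial_at p u (\<alpha> j) *\<^sub>R c j)"
      unfolding mon[symmetric] by (simp add: case_prod_unfold)
    finally show ?thesis .
  qed
  moreover have "R / 3 > 0"
    using \<open>R > 0\<close> by simp
  ultimately show "\<exists>r>0. \<exists>J (\<alpha> :: nat \<times> nat \<Rightarrow> complex^'n \<Rightarrow> nat) c. \<forall>u\<in>ball p r.
      ((\<lambda>j. monomial_at p u (\<alpha> j) *\<^sub>R c j) has_sum F (u $ i)) J"
    by (intro exI[of _ "R / 3"] conjI exI[of _ J] exI[of _ \<alpha>] exI[of _ c] ballI)
qed

section \<open>Monomial maps and toric charts\<close>

lemma real_analytic_on_monomial_map: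
  "(\<lambda>u. monomial_map \<sigma> u + a) real_analytic_on {u. monomial_map_defined \<sigma> u}"
proof (rule real_analytic_on_vec)
  fix i
  have powi: "(\<lambda>u :: complex^2. (u $ j) powi (\<sigma> $ i $ j)) real_analytic_on {u. monomial_map_defined \<sigma> u}"
    for j
  proof (rule real_analytic_on_holomorphic_nth)
    show "(\<lambda>z. z powi (\<sigma> $ i $ j)) holomorphic_on {z. \<sigma> $ i $ j < 0 \<longrightarrow> z \<noteq> 0}"
      by (auto intro!: holomorphic_intros)
    show "open {z :: complex. \<sigma> $ i $ j < 0 \<longrightarrow> z \<noteq> 0}"
      by (cases "\<sigma> $ i $ j < 0") (auto intro!: open_Collect_neq continuous_intros)
  qed (auto simp: monomial_map_defined_def)
  have "(\<lambda>u :: complex^2. a $ i) real_analytic_on {u. monomial_map_defined \<sigma> u}"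
    by (rule real_analytic_on_holomorphic_nth[of "\<lambda>_. a $ i" UNIV]) auto
  then show "(\<lambda>u. (monomial_map \<sigma> u + a) $ i) real_analytic_on {u. monomial_map_defined \<sigma> u}"
    unfolding monomial_map_nth vector_add_component
    by (intro real_analytic_on_add real_analytic_on_mult powi)
qed

lemma open_monomial_map_defined: "open {u. monomial_map_defined \<sigma> u}"
proof -
  have "open {u :: complex^2. \<sigma> $ i $ j < 0 \<longrightarrow> u $ j \<noteq> 0}" for i j
    by (cases "\<sigma> $ i $ j < 0") (auto intro!: open_Collect_neq continuous_intros)
  then show ?thesis
    unfolding monomial_map_defined_def Collect_all_eq by (intro open_INT) auto
qed

lemma continuous_on_monomial_map:
  "continuous_on {u. monomial_map_defined \<sigma> u} (monomial_map \<sigma>)"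
  unfolding monomial_map_def
  by (intro continuous_intros) (auto simp: monomial_map_defined_def not_less[symmetric])

definition transition :: "cone \<Rightarrow> cone \<Rightarrow> int^2^2" where
  "transition i j = matrix_inv (cone_matrix j) ** cone_matrix i"

lemma toric_chart_eq_iff:
  "toric_chart i u = toric_chart j v \<longleftrightarrow> glue (i, u) (j, v)"
  by (simp add: toric_chart_def toric_surface.abs_eq_iff)

lemma glue_transition_iff:
  "glue (i, u) (j, v) \<longleftrightarrow>
     monomial_map_defined (transition i j) u \<and> monomial_map (transition i j) u = v"
  by (simp add: glue_def transition_def)

lemma toric_chart_inject [simp]: "toric_chart i u = toric_chart i v \<longleftrightarrow> u = v"
  by (cases i) (auto simp: toric_chart_eq_iff glue_iff vec_eq_iff forall_2)

lemma inj_toric_chart: "inj (toric_chart i)"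
  by (simp add: inj_def)

lemma toric_surface_cases: obtains i u where "x = toric_chart i u"
proof -
  have "\<exists>i u. x = toric_chart i u"
    by (induct x rule: toric_surface.abs_induct) (auto simp: toric_chart_def)
  then show ?thesis using that by blast
qed

lemma continuous_on_toric_chart: "continuous_on S (toric_chart i)"
  by (rule continuous_on_subset[of UNIV])
    (auto simp: continuous_on_open_vimage[OF open_UNIV] open_toric_surface_def)

lemma open_toric_chart_image:
  assumes "open A" shows "open (toric_chart i ` A)"
  unfolding open_toric_surface_def
proof
  fix j
  have "toric_chart j -` toric_chart i ` A =
      monomial_map (transition j i) -` A \<inter> {u. monomial_map_defined (transition j i) u}"
    by (auto simp: toric_chart_eq_iff glue_transition_iff)
  also have "open \<dots>"
    using continuous_on_monomial_map open_monomial_map_defined assms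
    by (simp add: continuous_on_open_vimage)
  finally show "open (toric_chart j -` toric_chart i ` A)" .
qed

text \<open>
  Between this chart and any toric chart the coordinate changes are monomial maps followed or preceded by a
  translation. They are analytic where they are defined, and every point of an overlap is
  such a point.
\<close>

lemma real_analytic_chart_toric:
  fixes a :: "complex^2"
  assumes "open A"
  shows "real_analytic_chart (toric_chart i ` A) (\<lambda>x. inv (toric_chart i) x - a)"
proof -
  define U where "U = toric_chart i ` A"
  define \<phi> where "\<phi> x = inv (toric_chart i) x - a" for x
  have \<phi>_chart [simp]: "\<phi> (toric_chart i u) = u - a" for u
    by (simp add: \<phi>_def inv_f_f[OF inj_toric_chart])
  have \<phi>_image: "\<phi> ` toric_chart i ` B = {v. v + a \<in> B}" for B
    by (force simp: image_iff)
  have \<phi>U: "\<phi> ` U = {v. v + a \<in> A}"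
    unfolding U_def by (rule \<phi>_image)
  have inj: "inj_on \<phi> U"
    by (auto simp: inj_on_def U_def)
  have inv: "inv_into U \<phi> v = toric_chart i (v + a)" if "v + a \<in> A" for v
    using that by (intro inv_into_f_eq[OF inj]) (auto simp: U_def)
  have open_trans: "open {v. v + a \<in> B}" if "open B" for B
    using open_vimage[OF that, of "\<lambda>v. v + a"] by (simp add: vimage_def continuous_intros)
  have "open U"
    by (simp add: U_def assms open_toric_chart_image)
  moreover have "open (\<phi> ` U)"
    by (simp add: \<phi>U assms open_trans)
  moreover have "homeomorphism U (\<phi> ` U) \<phi> (inv_into U \<phi>)"
  proof
    have "open (\<phi> -` B \<inter> U)" if "open B" for B
    proof -
      have "\<phi> -` B \<inter> U = toric_chart i ` (A \<inter> (\<lambda>u. u - a) -` B)"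
        by (auto simp: U_def)
      also have "open \<dots>"
        using that assms by (intro open_toric_chart_image open_Int open_vimage continuous_intros)
      finally show ?thesis .
    qed
    with \<open>open U\<close> show "continuous_on U \<phi>"
      by (simp add: continuous_on_open_vimage)
    have "continuous_on (\<phi> ` U) (\<lambda>v. toric_chart i (v + a))"
      by (rule continuous_on_compose2[OF continuous_on_toric_chart[of UNIV]])
        (auto intro: continuous_intros)
    then show "continuous_on (\<phi> ` U) (inv_into U \<phi>)"
      by (rule continuous_on_eq) (auto simp: \<phi>U inv)
  qed (auto simp: inj inv_into_into f_inv_into_f)
  moreover have "(\<phi> \<circ> toric_chart j) real_analytic_on (toric_chart j -` U)" for j
  proof (rule real_analytic_on_cong)
    show "open (toric_chart j -` U)"
      using \<open>open U\<close> by (simp add: open_toric_surface_def)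
    have "(\<lambda>u. monomial_map (transition j i) u - a) real_analytic_on {u. monomial_map_defined (transition j i) u}"
      using real_analytic_on_monomial_map[of "transition j i" "- a"] by simp
    then show "(\<lambda>u. monomial_map (transition j i) u - a) real_analytic_on toric_chart j -` U"
      by (rule real_analytic_on_subset)
        (auto simp: U_def toric_chart_eq_iff glue_transition_iff)
    show "monomial_map (transition j i) u - a = (\<phi> \<circ> toric_chart j) u"
      if u: "u \<in> toric_chart j -` U" for u
    proof -
      from u obtain v where v: "toric_chart j u = toric_chart i v"
        by (auto simp: U_def)
      then have "monomial_map (transition j i) u = v"
        by (simp add: toric_chart_eq_iff glue_transition_iff)
      with v show ?thesis by simp
    qed
  qed
  moreover have "(inv (toric_chart j) \<circ> inv_into U \<phi>) real_analytic_on (\<phi> ` (U \<inter> range (toric_chart j)))" for j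
  proof (rule real_analytic_on_cong)
    define D where "D = {u. monomial_map_defined (transition i j) u}"
    have dom: "toric_chart i v \<in> range (toric_chart j) \<longleftrightarrow> v \<in> D" for v
      by (auto simp: D_def image_iff toric_chart_eq_iff glue_transition_iff)
    have im: "\<phi> ` (U \<inter> range (toric_chart j)) = {v. v + a \<in> A \<inter> D}"
    proof -
      have "U \<inter> range (toric_chart j) = toric_chart i ` (A \<inter> D)"
        using dom by (auto simp: U_def)
      then show ?thesis by (simp only: \<phi>_image)
    qed
    show "open (\<phi> ` (U \<inter> range (toric_chart j)))"
      unfolding im using assms by (intro open_trans open_Int) (auto simp: D_def open_monomial_map_defined)
    show "(\<lambda>v. monomial_map (transition i j) (v + a)) real_analytic_on \<phi> ` (U \<inter> range (toric_chart j))"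
      by (rule real_analytic_on_translation, rule real_analytic_on_subset[OF real_analytic_on_monomial_map[of _ 0, simplified]])
        (auto simp: im D_def)
    show "monomial_map (transition i j) (v + a) = (inv (toric_chart j) \<circ> inv_into U \<phi>) v"
      if "v \<in> \<phi> ` (U \<inter> range (toric_chart j))" for v
    proof -
      have "v + a \<in> A" "v + a \<in> D" using that im by auto
      then have "toric_chart i (v + a) = toric_chart j (monomial_map (transition i j) (v + a))"
        by (simp add: D_def toric_chart_eq_iff glue_transition_iff)
      then show ?thesis
        using \<open>v + a \<in> A\<close> by (simp add: inv inv_f_f[OF inj_toric_chart])
    qed
  qed
  ultimately show ?thesis
    unfolding real_analytic_chart_def U_def \<phi>_def by blast
qed

section \<open>The zero set and its strict transform\<close>

lemma mixed_cubic_eq_0_iff: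
  fixes w :: complex
  shows "w\<^sup>2 * cnj w - 6 * w * cnj w + 11 * w - 6 = 0 \<longleftrightarrow> w \<in> {1, 2, 3}"
proof
  assume eq: "w\<^sup>2 * cnj w - 6 * w * cnj w + 11 * w - 6 = 0"
  define r where "r = (norm w)\<^sup>2"
  have r: "of_real r = w * cnj w" "r \<ge> 0"
    by (simp_all only: r_def complex_norm_square zero_le_power2)
  have "w * (w * cnj w + 11) = 6 * (w * cnj w + 1)"
    using eq by (simp add: algebra_simps power2_eq_square)
  then have "w * of_real (r + 11) = of_real (6 * (r + 1))"
    by (simp add: r)
  moreover have "of_real (r + 11) \<noteq> (0 :: complex)"
    using r(2) by (simp only: of_real_eq_0_iff)
  ultimately have "w = of_real (6 * (r + 1)) / of_real (r + 11)"
    by (rule nonzero_eq_divide_eq[THEN iffD2, rotated])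
  then have w: "w = of_real (6 * (r + 1) / (r + 11))"
    by (simp only: of_real_divide)
  define t where "t = 6 * (r + 1) / (r + 11)"
  have t: "w = of_real t"
    unfolding t_def by (rule w)
  have "of_real ((t - 1) * (t - 2) * (t - 3)) = (0 :: complex)"
    using eq by (simp add: t algebra_simps power2_eq_square)
  then have "(t - 1) * (t - 2) * (t - 3) = 0" by (simp only: of_real_eq_0_iff)
  then show "w \<in> {1, 2, 3}" by (auto simp: t)
qed auto

lemma zero_set_parabolas:
  fixes x y :: complex
  shows "y\<^sup>2 * cnj y - 6 * x\<^sup>2 * y * cnj y + 11 * x\<^sup>2 * (cnj x)\<^sup>2 * y - 6 * x ^ 4 * (cnj x)\<^sup>2 = 0
    \<longleftrightarrow> (\<exists>c\<in>{1, 2, 3}. y = c * x\<^sup>2)"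
    (is "?f x y = 0 \<longleftrightarrow> _")
proof (cases "x = 0")
  case False
  define w where "w = y / x\<^sup>2"
  have y: "y = w * x\<^sup>2" using False by (simp add: w_def)
  have "?f x y = x ^ 4 * (cnj x)\<^sup>2 * (w\<^sup>2 * cnj w - 6 * w * cnj w + 11 * w - 6)"
    by (simp add: y algebra_simps power2_eq_square power4_eq_xxxx)
  then have "?f x y = 0 \<longleftrightarrow> w\<^sup>2 * cnj w - 6 * w * cnj w + 11 * w - 6 = 0"
    using False by simp
  also note mixed_cubic_eq_0_iff
  finally have "?f x y = 0 \<longleftrightarrow> w \<in> {1, 2, 3}" .
  then show ?thesis using False by (auto simp: w_def field_simps)
qed auto

definition lifted_parabolas :: "toric_surface set" where
  "lifted_parabolas = toric_chart Cone_P_E2 ` {u. u $ 2 \<in> {1, 2, 3}}"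

lemma toric_chart_in_lifted_parabolas_iff:
  "toric_chart i u \<in> lifted_parabolas \<longleftrightarrow> (\<exists>v. glue (i, u) (Cone_P_E2, v) \<and> v $ 2 \<in> {1, 2, 3})"
  by (auto simp: lifted_parabolas_def image_iff toric_chart_eq_iff)

text \<open>
  The lifted parabolas stay away from the part of each of the other two charts that is not covered by the chart
  of \<open>Cone_P_E2\<close>: on that part the monomial that expresses the reciprocal of the second coordinate
  vanishes, whereas it lies in the finite set \<open>{1, 1/2, 1/3}\<close> on the parabolas.
\<close>

lemma closed_lifted_parabolas: "closed lifted_parabolas"
proof -
  define C where "C = {1, 2, 3 :: complex}"
  have C: "finite C" "0 \<notin> C"
    by (auto simp: C_def)
  have inv: "z \<noteq> 0 \<and> inverse z \<in> C \<longleftrightarrow> z \<in> inverse ` C" for z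
    using C(2) by (metis image_iff inverse_inverse_eq inverse_zero)
  have "closed (toric_chart i -` lifted_parabolas)" for i
  proof (cases i)
    case Cone_P_E2
    have "toric_chart i -` lifted_parabolas = (\<lambda>u. u $ 2) -` C"
      by (auto simp: lifted_parabolas_def Cone_P_E2 C_def)
    also have "closed \<dots>"
      using C(1) by (intro closed_vimage finite_imp_closed continuous_intros)
    finally show ?thesis .
  next
    case Cone_S_P
    have "toric_chart i u \<in> lifted_parabolas \<longleftrightarrow> u $ 1 \<noteq> 0 \<and> inverse (u $ 1) \<in> C" for u
    proof
      assume "u $ 1 \<noteq> 0 \<and> inverse (u $ 1) \<in> C"
      then have "glue (i, u) (Cone_P_E2, vector [u $ 1 * u $ 2, inverse (u $ 1)])"
        and "(vector [u $ 1 * u $ 2, inverse (u $ 1)] :: complex^2) $ 2 \<in> C"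
        by (auto simp: Cone_S_P glue_iff)
      then show "toric_chart i u \<in> lifted_parabolas"
        unfolding toric_chart_in_lifted_parabolas_iff C_def by blast
    qed (auto simp: toric_chart_in_lifted_parabolas_iff C_def Cone_S_P glue_iff)
    then have "toric_chart i -` lifted_parabolas = (\<lambda>u. u $ 1) -` inverse ` C"
      by (auto simp only: inv vimage_def)
    also have "closed \<dots>"
      using C(1) by (intro closed_vimage finite_imp_closed continuous_intros) simp
    finally show ?thesis .
  next
    case Cone_E1_S
    have "toric_chart i u \<in> lifted_parabolas \<longleftrightarrow> (u $ 1)\<^sup>2 * u $ 2 \<noteq> 0 \<and> inverse ((u $ 1)\<^sup>2 * u $ 2) \<in> C" for u
    proof
      assume "(u $ 1)\<^sup>2 * u $ 2 \<noteq> 0 \<and> inverse ((u $ 1)\<^sup>2 * u $ 2) \<in> C"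
      then have "glue (i, u) (Cone_P_E2, vector [u $ 1 * u $ 2, inverse ((u $ 1)\<^sup>2 * u $ 2)])"
        and "(vector [u $ 1 * u $ 2, inverse ((u $ 1)\<^sup>2 * u $ 2)] :: complex^2) $ 2 \<in> C"
        by (auto simp: Cone_E1_S glue_iff)
      then show "toric_chart i u \<in> lifted_parabolas"
        unfolding toric_chart_in_lifted_parabolas_iff C_def by blast
    qed (auto simp: toric_chart_in_lifted_parabolas_iff C_def Cone_E1_S glue_iff)
    then have "toric_chart i -` lifted_parabolas = (\<lambda>u. (u $ 1)\<^sup>2 * u $ 2) -` inverse ` C"
      by (auto simp only: inv vimage_def)
    also have "closed \<dots>"
      using C(1) by (intro closed_vimage finite_imp_closed continuous_intros) simp
    finally show ?thesis .
  qed
  then show ?thesis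
    by (simp add: closed_def open_toric_surface_def vimage_Compl)
qed

lemma closure_punctured_line:
  fixes u :: "complex^2"
  shows "u \<in> closure {v. v $ 1 \<noteq> 0 \<and> v $ 2 = u $ 2}"
proof (cases "u $ 1 = 0")
  case True
  show ?thesis
    unfolding closure_approachable
  proof safe
    fix e :: real assume "e > 0"
    have "dist (u + axis 1 (of_real (e / 2))) u < e"
      using \<open>e > 0\<close> by (simp add: dist_norm norm_vec_def L2_set_def sum_2 axis_def)
    with True \<open>e > 0\<close> show "\<exists>v\<in>{v. v $ 1 \<noteq> 0 \<and> v $ 2 = u $ 2}. dist v u < e"
      by (intro bexI[of _ "u + axis 1 (of_real (e / 2))"]) (auto simp: axis_def)
  qed
qed (use closure_subset in force)

text \<open>
  The points over \<open>V - {0}\<close> lie on the lifted parabolas, whose union is closed; conversely, the only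
  other points of a lifted parabola are those with \<open>u1 = 0\<close>, which are limits along it.
\<close>

lemma strict_transform_eq:
  assumes V: "\<And>z. z \<in> V \<longleftrightarrow> (\<exists>c\<in>{1, 2, 3}. z $ 2 = c * (z $ 1)\<^sup>2)"
  shows "strict_transform V = lifted_parabolas"
proof
  have "toric_modification -` (V - {0}) \<subseteq> lifted_parabolas"
  proof
    fix x assume x: "x \<in> toric_modification -` (V - {0})"
    obtain i u where u: "x = toric_chart i u" by (rule toric_surface_cases)
    define z where "z = monomial_map (cone_matrix i) u"
    have z: "z \<noteq> 0" "z \<in> V" using x by (auto simp: u z_def toric_modification_chart)
    then obtain c where c: "c \<in> {1, 2, 3}" "z $ 2 = c * (z $ 1)\<^sup>2" using V by blast
    with z have z1: "z $ 1 \<noteq> 0" by (auto simp: vec_eq_iff forall_2)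
    have "glue (i, u) (Cone_P_E2, vector [z $ 1, c])"
      using z1 c
      by (cases i) (auto simp: glue_iff z_def monomial_map_nth cone_matrix_explicit field_simps power2_eq_square)
    with c show "x \<in> lifted_parabolas"
      unfolding u lifted_parabolas_def toric_chart_eq_iff[symmetric] by force
  qed
  then show "strict_transform V \<subseteq> lifted_parabolas"
    unfolding strict_transform_def by (rule closure_minimal[OF _ closed_lifted_parabolas])
next
  show "lifted_parabolas \<subseteq> strict_transform V"
  proof
    fix x assume "x \<in> lifted_parabolas"
    then obtain u where u: "x = toric_chart Cone_P_E2 u" "u $ 2 \<in> {1, 2, 3}"
      by (auto simp: lifted_parabolas_def)
    define L where "L = {v :: complex^2. v $ 1 \<noteq> 0 \<and> v $ 2 = u $ 2}"
    have "toric_chart Cone_P_E2 ` L \<subseteq> toric_modification -` (V - {0})"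
    proof safe
      fix v assume v: "v \<in> L"
      have z: "toric_modification (toric_chart Cone_P_E2 v) $ 1 = v $ 1"
        "toric_modification (toric_chart Cone_P_E2 v) $ 2 = u $ 2 * (v $ 1)\<^sup>2"
        using v by (auto simp: L_def toric_modification_chart monomial_map_nth cone_matrix_explicit)
      show "toric_chart Cone_P_E2 v \<in> toric_modification -` (V - {0})"
        using z v u(2) by (auto simp: V L_def)
    qed
    then have "toric_chart Cone_P_E2 ` L \<subseteq> strict_transform V"
      unfolding strict_transform_def using closure_subset by blast
    then have "toric_chart Cone_P_E2 ` closure L \<subseteq> strict_transform V"
      by (intro image_closure_subset continuous_on_toric_chart)
        (auto simp: strict_transform_def)
    then show "x \<in> strict_transform V"
      using closure_punctured_line[of u] by (auto simp: u L_def)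
  qed
qed

text \<open>
  Any two of the values \<open>1, 2, 3\<close> are at least \<open>1\<close> apart, so the neighbourhood \<open>\<bar>v2 - u2\<bar> < 1\<close> of a point \<open>u\<close>
  of a lifted parabola meets no other one.
\<close>

lemma real_analytic_submanifold_lifted_parabolas:
  "real_analytic_submanifold UNIV lifted_parabolas"
proof -
  define L where "L = {v :: complex^2. v $ 2 = 0}"
  have L: "subspace L"
    by (auto simp: L_def subspace_def)
  have "\<exists>U \<phi> L'. real_analytic_chart U \<phi> \<and> p \<in> U \<and> U \<subseteq> UNIV \<and>
      subspace L' \<and> dim L' = dim L \<and> \<phi> ` (lifted_parabolas \<inter> U) = \<phi> ` U \<inter> L'"
    if "p \<in> lifted_parabolas" for p
  proof -
    from that
    obtain u where u: "p = toric_chart Cone_P_E2 u" "u $ 2 \<in> {1, 2, 3}"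
      by (auto simp: lifted_parabolas_def)
    define A where "A = {v :: complex^2. dist (v $ 2) (u $ 2) < 1}"
    define U where "U = toric_chart Cone_P_E2 ` A"
    define \<phi> where "\<phi> = (\<lambda>x. inv (toric_chart Cone_P_E2) x - axis 2 (u $ 2))"
    have "open A"
      unfolding A_def by (intro open_Collect_less continuous_intros)
    have "real_analytic_chart U \<phi>"
      unfolding U_def \<phi>_def by (rule real_analytic_chart_toric[OF \<open>open A\<close>])
    moreover have "p \<in> U"
      by (auto simp: U_def A_def u)
    moreover have only: "v $ 2 = u $ 2" if "v \<in> A" "v $ 2 \<in> {1, 2, 3}" for v
      using that u(2) by (auto simp: A_def dist_norm)
    have "{v. v $ 2 \<in> {1, 2, 3}} \<inter> A = {v \<in> A. v $ 2 = u $ 2}"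
      using only u(2) by (intro equalityI subsetI) (blast, simp)
    then have "lifted_parabolas \<inter> U = toric_chart Cone_P_E2 ` {v \<in> A. v $ 2 = u $ 2}"
      by (simp add: lifted_parabolas_def U_def flip: image_Int[OF inj_toric_chart])
    then have "\<phi> ` (lifted_parabolas \<inter> U) = \<phi> ` U \<inter> L"
      by (auto simp: U_def \<phi>_def L_def image_image inv_f_f[OF inj_toric_chart])
    ultimately show ?thesis
      using L by (intro exI[of _ U] exI[of _ \<phi>] exI[of _ L] conjI) simp_all
  qed
  then show ?thesis
    unfolding real_analytic_submanifold_def by (intro conjI subset_UNIV exI[of _ "dim L"] ballI)
qed

theorem theorem15:
  fixes f :: "complex^2 \<Rightarrow> complex"
  assumes f_def: "\<And>z. f z = (z $ 2)^2 * cnj (z $ 2) - 6 * (z $ 1)^2 * (z $ 2) * cnj (z $ 2)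
      + 11 * (z $ 1)^2 * (cnj (z $ 1))^2 * (z $ 2) - 6 * (z $ 1)^4 * (cnj (z $ 1))^2"
  defines "V \<equiv> f -` {0}"
  shows "\<exists>W. open W \<and> strict_transform V \<inter> toric_modification -` {0} \<subseteq> W \<and>
             real_analytic_submanifold W (strict_transform V \<inter> W)"
proof (intro exI conjI)
  have "strict_transform V = lifted_parabolas"
    by (rule strict_transform_eq) (simp only: V_def vimage_singleton_eq f_def zero_set_parabolas)
  then show "real_analytic_submanifold UNIV (strict_transform V \<inter> UNIV)"
    by (simp add: real_analytic_submanifold_lifted_parabolas)
qed auto

end
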